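(* Let $C=\{x\in\mathbb{R}^n:x>0\}$, $\mathcal{M}=\{x\in\mathbb{R}^n:Ax=b\}$, and let $\phi$ be a separable kernel as described in the context. Let $x(t)$, $t\ge0$, be a trajectory of $$\dot x(t)\in-\mathrm{P}_{x(t)}\nabla^2\phi(x(t))^{-1}\partial f(x(t))\ \text{ for a.e. }t>0,\qquad x(0)\in\mathcal{M}\cap C.$$ For any spurious stationary point $\bar x\in\mathcal{S}\setminus\Omega$ there exists a neighborhood $\mathcal{N}$ of $\bar x$ such that the following holds. Put $T_{-1}:=0$ and, for $k\ge0$, $$\tau_k:=\inf\{t\ge T_{k-1}:x(t)\in\mathcal{N}\cap\mathcal{M}\cap C\},$$ $$T_k:=\tau_k+\sup\{T\ge 0:x(t)\in\mathcal{N}\cap\mathcal{M}\cap C\text{ for all }t\in[\tau_k,\tau_k+T)\}.$$ If the trajectory enters $\mathcal{N}$ at time $\tau_k<\infty$, then it exits $\mathcal{N}$ in finite time, i.e. $T_k<\infty$.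
   Context: $f:\mathbb{R}^n\to\mathbb{R}$ is locally Lipschitz and path-differentiable: for every absolutely continuous curve $z:[0,\infty)\to\mathbb{R}^n$, $f\circ z$ is absolutely continuous and $\frac{d}{dt}f(z(t))=\langle v,\dot z(t)\rangle$ for all $v\in\partial f(z(t))$ and a.e. $t$; $\partial f$ is the Clarke subdifferential. $A\in\mathbb{R}^{m\times n}$ has full row rank. Kernel: $\phi(x)=\sum_{i=1}^n\phi_i(x_i)$, where each $\phi_i$ is differentiable and strictly convex on $(0,\infty)$ with $|\phi_i'(t)|\to\infty$ as $t\to0^+$, and there exist $\gamma>0$ and continuous $\psi_i:\mathbb{R}\to(0,\infty)$ with $\phi_i''(t)=t^{-\gamma}\psi_i(t)$ for $t>0$. Put $H(x)=\nabla^2\phi(x)$; $H(x)^{-1}=\mathrm{Diag}(x_i^\gamma\psi_i(x_i)^{-1})$ extends continuously to $\overline{C}$. For $x\in\mathcal{M}\cap C$, $\mathrm{P}_x=I-H(x)^{-1}A^T(AH(x)^{-1}A^T)^{-1}A$ is the projection onto $\{z:Az=0\}$ in the metric $u^TH(x)v$; it is a standing assumption that $\mathrm{P}_xH(x)^{-1}$ extends continuously to $\mathcal{M}\cap\overline{C}$. Trajectories are absolutely continuous and stay in $\mathcal{M}\cap C$ for all $t\ge0$. Stable set: $\mathcal{S}=\{x\in\mathcal{M}\cap\overline{C}:0\in H(x)^{-1}(\partial f(x)+\mathrm{range}(A^T))\}$. Stationary set: $\Omega=\{x\in\mathcal{M}\cap\overline{C}:0\in\partial f(x)+\mathrm{range}(A^T)+N_{\overline{C}}(x)\}$,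 with $N_{\overline{C}}$ the normal cone of convex analysis. *)

theory Defs
  imports "HOL-Analysis.Analysis"
begin

section \<open>Absolutely continuous curves\<close>

definition abs_continuous_on :: "real set \<Rightarrow> (real \<Rightarrow> 'a::real_normed_vector) \<Rightarrow> bool" where
  "abs_continuous_on S z \<longleftrightarrow>
    (\<forall>\<epsilon>>0. \<exists>\<delta>>0. \<forall>D :: (real \<times> real) set.
       finite D \<and> (\<forall>(s, t) \<in> D. s \<le> t \<and> {s..t} \<subseteq> S) \<and>
       disjoint_family_on (\<lambda>(s, t). {s<..<t}) D \<and>
       (\<Sum>(s, t)\<in>D. t - s) < \<delta>
       \<longrightarrow> (\<Sum>(s, t)\<in>D. norm (z t - z s)) < \<epsilon>)"

text \<open>On the unbounded interval \<open>[0, \<infinity>)\<close> absolute continuity is, as usual for trajectories,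
  absolute continuity on every compact subinterval.\<close>

definition abs_continuous_curve :: "(real \<Rightarrow> 'a::real_normed_vector) \<Rightarrow> bool" where
  "abs_continuous_curve z \<longleftrightarrow> (\<forall>T\<ge>0. abs_continuous_on {0..T} z)"


section \<open>Clarke subdifferential and path-differentiability\<close>

definition locally_lipschitz :: "('a::metric_space \<Rightarrow> 'b::metric_space) \<Rightarrow> bool" where
  "locally_lipschitz f \<longleftrightarrow> (\<forall>x. \<exists>u>0. \<exists>L. L-lipschitz_on (cball x u) f)"

definition clarke_dir_deriv :: "('a::real_normed_vector \<Rightarrow> real) \<Rightarrow> 'a \<Rightarrow> 'a \<Rightarrow> ereal" where
  "clarke_dir_deriv f x d =
     Limsup (nhds x \<times>\<^sub>F at_right 0) (\<lambda>(y, h). ereal ((f (y + h *\<^sub>R d) - f y) / h))"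

definition clarke_subdiff :: "('a::real_inner \<Rightarrow> real) \<Rightarrow> 'a \<Rightarrow> 'a set" where
  "clarke_subdiff f x = {v. \<forall>d. ereal (v \<bullet> d) \<le> clarke_dir_deriv f x d}"

definition path_differentiable :: "('a::real_inner \<Rightarrow> real) \<Rightarrow> bool" where
  "path_differentiable f \<longleftrightarrow>
    (\<forall>z. abs_continuous_curve z \<longrightarrow>
       abs_continuous_curve (f \<circ> z) \<and>
       (AE t in lebesgue. 0 < t \<longrightarrow>
          (\<exists>z'. (z has_vector_derivative z') (at t) \<and>
             (\<forall>v \<in> clarke_subdiff f (z t).
                ((f \<circ> z) has_real_derivative (v \<bullet> z')) (at t)))))"


section \<open>Constraint sets\<close>

definition pos_orthant :: "(real ^ 'n) set" where
  "pos_orthant = {x. \<forall>i. 0 < x $ i}"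

definition affine_set :: "real ^ 'n ^ 'm \<Rightarrow> real ^ 'm \<Rightarrow> (real ^ 'n) set" where
  "affine_set A b = {x. A *v x = b}"

definition normal_cone :: "'a::real_inner set \<Rightarrow> 'a \<Rightarrow> 'a set" where
  "normal_cone K x = (if x \<in> K then {u. \<forall>y\<in>K. u \<bullet> (y - x) \<le> 0} else {})"


section \<open>Separable kernels and the induced geometry\<close>

definition strictly_convex_on :: "real set \<Rightarrow> (real \<Rightarrow> real) \<Rightarrow> bool" where
  "strictly_convex_on S g \<longleftrightarrow> convex S \<and>
    (\<forall>x\<in>S. \<forall>y\<in>S. \<forall>u. x \<noteq> y \<and> 0 < u \<and> u < 1 \<longrightarrow>
       g ((1 - u) * x + u * y) < (1 - u) * g x + u * g y)"

definition separable :: "('n \<Rightarrow> real \<Rightarrow> real) \<Rightarrow> real ^ 'n \<Rightarrow> real" where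
  "separable \<phi> x = (\<Sum>i\<in>UNIV. \<phi> i (x $ i))"

definition separable_kernel :: "('n::finite \<Rightarrow> real \<Rightarrow> real) \<Rightarrow> bool" where
  "separable_kernel \<phi> \<longleftrightarrow>
    (\<forall>i. (\<forall>t>0. \<phi> i differentiable (at t)) \<and>
         strictly_convex_on {0<..} (\<phi> i) \<and>
         filterlim (\<lambda>t. \<bar>deriv (\<phi> i) t\<bar>) at_top (at_right 0)) \<and>
    (\<exists>\<gamma>>0. \<exists>\<psi> :: 'n \<Rightarrow> real \<Rightarrow> real. \<forall>i.
       continuous_on UNIV (\<psi> i) \<and> (\<forall>t. 0 < \<psi> i t) \<and>
       (\<forall>t>0. (deriv (\<phi> i) has_real_derivative (t powr (- \<gamma>) * \<psi> i t)) (at t)))"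

definition gradient :: "('a::real_inner \<Rightarrow> real) \<Rightarrow> 'a \<Rightarrow> 'a" where
  "gradient g x = (THE D. GDERIV g x :> D)"

definition hessian :: "(real ^ 'n \<Rightarrow> real) \<Rightarrow> real ^ 'n \<Rightarrow> real ^ 'n ^ 'n" where
  "hessian g x = jacobian (gradient g) (at x)"

text \<open>The inverse Hessian on the open orthant, continuously extended to its closure. For a
  separable kernel it is \<open>Diag (x\<^sub>i powr \<gamma> / \<psi>\<^sub>i x\<^sub>i)\<close> throughout, so the limit exists; by contrast
  \<open>hessian g x\<close> itself carries no information at a boundary point.\<close>

definition inv_hessian :: "(real ^ 'n \<Rightarrow> real) \<Rightarrow> real ^ 'n \<Rightarrow> real ^ 'n ^ 'n" where
  "inv_hessian g x =
    (if x \<in> pos_orthant then matrix_inv (hessian g x)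
     else Lim (at x within pos_orthant) (\<lambda>y. matrix_inv (hessian g y)))"

definition metric_proj ::
  "real ^ 'n ^ 'm \<Rightarrow> (real ^ 'n \<Rightarrow> real) \<Rightarrow> real ^ 'n \<Rightarrow> real ^ 'n ^ 'n" where
  "metric_proj A g x =
    mat 1 - inv_hessian g x ** transpose A
            ** matrix_inv (A ** inv_hessian g x ** transpose A) ** A"

definition stable_set ::
  "(real ^ 'n \<Rightarrow> real) \<Rightarrow> real ^ 'n ^ 'm \<Rightarrow> real ^ 'm \<Rightarrow> (real ^ 'n \<Rightarrow> real) \<Rightarrow> (real ^ 'n) set" where
  "stable_set f A b g =
    {x \<in> affine_set A b \<inter> closure pos_orthant.
       \<exists>v \<in> clarke_subdiff f x. \<exists>y. inv_hessian g x *v (v + transpose A *v y) = 0}"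

definition stationary_set ::
  "(real ^ 'n \<Rightarrow> real) \<Rightarrow> real ^ 'n ^ 'm \<Rightarrow> real ^ 'm \<Rightarrow> (real ^ 'n) set" where
  "stationary_set f A b =
    {x \<in> affine_set A b \<inter> closure pos_orthant.
       \<exists>v \<in> clarke_subdiff f x. \<exists>y. \<exists>u \<in> normal_cone (closure pos_orthant) x.
         v + transpose A *v y + u = 0}"

definition is_trajectory ::
  "(real ^ 'n \<Rightarrow> real) \<Rightarrow> real ^ 'n ^ 'm \<Rightarrow> real ^ 'm \<Rightarrow> (real ^ 'n \<Rightarrow> real)
     \<Rightarrow> (real \<Rightarrow> real ^ 'n) \<Rightarrow> bool" where
  "is_trajectory f A b g x \<longleftrightarrow>
    abs_continuous_curve x \<and>
    (\<forall>t\<ge>0. x t \<in> affine_set A b \<inter> pos_orthant) \<and>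
    (AE t in lebesgue. 0 < t \<longrightarrow>
       (\<exists>v \<in> clarke_subdiff f (x t).
          (x has_vector_derivative
             - ((metric_proj A g (x t) ** inv_hessian g (x t)) *v v)) (at t)))"


section \<open>Entry and exit times\<close>

definition entry_time :: "(real \<Rightarrow> 'a) \<Rightarrow> 'a set \<Rightarrow> ereal \<Rightarrow> ereal" where
  "entry_time x W T = Inf (ereal ` {t. T \<le> ereal t \<and> x t \<in> W})"

definition exit_time :: "(real \<Rightarrow> 'a) \<Rightarrow> 'a set \<Rightarrow> ereal \<Rightarrow> ereal" where
  "exit_time x W \<tau> =
    \<tau> + Sup (ereal ` {T. 0 \<le> T \<and> (\<forall>t. \<tau> \<le> ereal t \<and> ereal t < \<tau> + ereal T \<longrightarrow> x t \<in> W)})"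

text \<open>Indices are shifted by one: \<open>exit_seq x W k\<close> is \<open>T\<^bsub>k-1\<^esub>\<close>, starting with \<open>T\<^bsub>-1\<^esub> = 0\<close>.\<close>

primrec exit_seq :: "(real \<Rightarrow> 'a) \<Rightarrow> 'a set \<Rightarrow> nat \<Rightarrow> ereal" where
  "exit_seq x W 0 = 0"
| "exit_seq x W (Suc k) = exit_time x W (entry_time x W (exit_seq x W k))"

definition tau :: "(real \<Rightarrow> 'a) \<Rightarrow> 'a set \<Rightarrow> nat \<Rightarrow> ereal" where
  "tau x W k = entry_time x W (exit_seq x W k)"

definition Texit :: "(real \<Rightarrow> 'a) \<Rightarrow> 'a set \<Rightarrow> nat \<Rightarrow> ereal" where
  "Texit x W k = exit_seq x W (Suc k)"

text \<open>The infimum \<open>tau x W k\<close> need not be attained (e.g. if \<open>W\<close> is relatively open and the curve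
  enters from outside); then \<open>Texit x W k = tau x W k\<close> and finiteness of \<open>Texit\<close> alone does not
  say that the curve leaves. The following predicate states leaving in finite time directly.\<close>

definition exits_in_finite_time :: "(real \<Rightarrow> 'a) \<Rightarrow> 'a set \<Rightarrow> bool" where
  "exits_in_finite_time x N \<longleftrightarrow> (\<forall>s\<ge>0. x s \<in> N \<longrightarrow> (\<exists>t>s. x t \<notin> N))"

end

theory Submission
  imports Defs
begin

text \<open>
  The mirror variable \<open>\<nabla>\<phi>(x(t))\<close> obeys a simple equation along the flow. Multiplying the
  dynamics by the Hessian \<open>H\<close> cancels the metric: \<open>H P H\<^sup>-\<^sup>1 v\<close> differs from \<open>v\<close> only by an element
  of \<open>range A\<^sup>T\<close>, so for every \<open>d\<close> with \<open>A d = 0\<close> the scalar \<open>\<langle>\<nabla>\<phi>(x(t)), d\<rangle>\<close> has derivative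
  \<open>- \<langle>v, d\<rangle>\<close> for some \<open>v \<in> \<partial>f(x(t))\<close> (lemma \<open>inner_hessian_projected_gradient\<close>).

  Since \<open>xbar\<close> is not stationary, the compact convex set \<open>- \<partial>f(xbar)\<close> misses the polyhedral cone
  \<open>range A\<^sup>T + N(xbar)\<close>. Strict separation (lemma \<open>descent_direction\<close>) yields a direction \<open>d\<close> with
  \<open>A d = 0\<close>, with \<open>d\<^sub>i \<ge> 0\<close> for each vanishing coordinate \<open>xbar\<^sub>i\<close>, and with
  \<open>\<langle>v, d\<rangle> < - c < 0\<close> on \<open>\<partial>f(xbar)\<close>; upper semicontinuity of the Clarke subdifferential extends the last
  inequality to all points near \<open>xbar\<close> (lemma \<open>clarke_subdiff_halfspace_nearby\<close>).

  As long as the trajectory stays in a small ball around \<open>xbar\<close>, the quantity \<open>\<langle>\<nabla>\<phi>(x(t)), d\<rangle>\<close>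
  therefore grows at least at rate \<open>c\<close> (lemma \<open>mirror_variable_growth\<close>). On the other hand it is
  bounded above on that ball (lemma \<open>mirror_variable_bounded_above\<close>): if \<open>xbar\<^sub>i > 0\<close>, then \<open>\<phi>\<^sub>i'\<close> is
  bounded near \<open>xbar\<^sub>i\<close>, and if \<open>xbar\<^sub>i = 0\<close>, then \<open>d\<^sub>i \<ge> 0\<close> and the increasing function \<open>\<phi>\<^sub>i'\<close> can
  only diverge to \<open>- \<infinity>\<close> at \<open>0\<close>. Hence the trajectory cannot stay forever.
\<close>

section \<open>Growth of absolutely continuous functions\<close>

lemma sum_lengths_le_measure:
  fixes D :: "(real \<times> real) set"
  assumes "finite D" and le: "\<And>s t. (s, t) \<in> D \<Longrightarrow> s \<le> t"
    and disj: "disjoint_family_on (\<lambda>(s, t). {s<..<t}) D"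
    and sub: "\<And>s t. (s, t) \<in> D \<Longrightarrow> {s<..<t} \<subseteq> U" and U: "U \<in> lmeasurable"
  shows "(\<Sum>(s, t)\<in>D. t - s) \<le> measure lebesgue U"
proof -
  have "(\<Sum>(s, t)\<in>D. t - s) = (\<Sum>p\<in>D. measure lebesgue (case p of (s, t) \<Rightarrow> {s<..<t}))"
    using le by (intro sum.cong) auto
  also have "\<dots> = measure lebesgue (\<Union>p\<in>D. case p of (s, t) \<Rightarrow> {s<..<t})"
    using assms by (intro measure_finite_Union[symmetric]) (auto split: prod.splits simp: emeasure_lborel_Ioo)
  also have "\<dots> \<le> measure lebesgue U"
    using sub \<open>finite D\<close> by (intro measure_mono_fmeasurable[OF _ _ U] sets.finite_UN) (auto split: prod.splits)
  finally show ?thesis .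
qed

text \<open>
  Cousin's argument, which avoids Lebesgue integration. At a point outside the exceptional null
  set \<open>E\<close> a fine gauge forces each increment of \<open>g\<close> to be at least \<open>c - e\<close> times the length of
  the interval. At a point of \<open>E\<close> the gauge is an open set \<open>U\<close> of small measure containing \<open>E\<close>, so
  the intervals tagged in \<open>E\<close> have small total length and, by absolute continuity, contribute
  little to \<open>g b - g a\<close>.
\<close>

lemma abs_continuous_growth:
  fixes g :: "real \<Rightarrow> real"
  assumes ab: "a \<le> b" and ac: "abs_continuous_on {a..b} g"
    and deriv: "AE t in lebesgue. a < t \<and> t < b \<longrightarrow> (\<exists>D\<ge>c. (g has_real_derivative D) (at t))"
  shows "c * (b - a) \<le> g b - g a"
proof (rule field_le_epsilon)
  fix e0 :: real assume "e0 > 0"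
  define e where "e = e0 / (2 + (b - a))"
  have e: "e > 0" using \<open>e0 > 0\<close> ab by (simp add: e_def)
  have e0: "e0 = 2 * e + e * (b - a)"
  proof -
    have "e0 = e * (2 + (b - a))" using ab by (simp add: e_def)
    then show ?thesis by (simp add: algebra_simps)
  qed
  \<comment> \<open>The endpoints are put among the exceptional points because the derivative is controlled only inside the interval.\<close>
  define E where "E = insert a (insert b {t. \<not> (a < t \<and> t < b \<longrightarrow> (\<exists>D\<ge>c. (g has_real_derivative D) (at t)))})"
  have "{t. \<not> (a < t \<and> t < b \<longrightarrow> (\<exists>D\<ge>c. (g has_real_derivative D) (at t)))} \<in> null_sets lebesgue"
    using deriv by (simp add: completion.AE_iff_null_sets)
  then have E: "negligible E" by (simp add: E_def negligible_iff_null_sets[symmetric])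
  obtain d where d: "d > 0" and acd: "\<And>D. finite D \<Longrightarrow> (\<forall>(s, t) \<in> D. s \<le> t \<and> {s..t} \<subseteq> {a..b}) \<Longrightarrow>
       disjoint_family_on (\<lambda>(s, t). {s<..<t}) D \<Longrightarrow> (\<Sum>(s, t)\<in>D. t - s) < d
       \<Longrightarrow> (\<Sum>(s, t)\<in>D. norm (g t - g s)) < e"
    using ac e unfolding abs_continuous_on_def by meson
  \<comment> \<open>The second bound makes the linear term over the exceptional intervals, with coefficient \<open>c - e\<close>, at most \<open>e\<close>.\<close>
  define d' where "d' = min d (e / (1 + \<bar>c - e\<bar>))"
  have d': "d' > 0" using d e by (auto simp: d'_def)
  obtain U where U: "open U" "E \<subseteq> U" "U \<in> lmeasurable" "measure lebesgue U < d'"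
  proof -
    obtain T where T: "open T" "E \<subseteq> T" "T - E \<in> lmeasurable" "emeasure lebesgue (T - E) < ennreal d'"
      using sets_lebesgue_outer_open[OF negligible_imp_sets[OF E] d'] .
    have En: "E \<in> null_sets lebesgue" using E by (simp add: negligible_iff_null_sets)
    have "T \<in> lmeasurable"
      using T E negligible_imp_measurable[of E] fmeasurable.Un[of "T - E" lebesgue E] by (simp add: Un_absorb2)
    moreover have "measure lebesgue T = measure lebesgue (T - E)"
      using En T calculation by (simp add: measure_Diff_null_set fmeasurableD)
    moreover have "measure lebesgue (T - E) < d'"
      using T(3,4) d' by (simp add: emeasure_eq_measure2 ennreal_less_iff)
    ultimately show ?thesis using T that by metis
  qed
  have "\<exists>r>0. \<forall>u v. u \<le> t \<longrightarrow> t \<le> v \<longrightarrow> {u..v} \<subseteq> ball t r \<longrightarrow> (c - e) * (v - u) \<le> g v - g u"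
    if t: "t \<notin> E" "a \<le> t" "t \<le> b" for t
  proof -
    from t obtain D where D: "D \<ge> c" "(g has_real_derivative D) (at t)"
      by (force simp: E_def)
    from D(2) e obtain r where r: "r > 0"
      "\<And>y. norm (y - t) < r \<Longrightarrow> norm (g y - g t - D * (y - t)) \<le> e * norm (y - t)"
      unfolding has_field_derivative_def has_derivative_at_alt by meson
    show ?thesis
    proof (intro exI[of _ r] conjI allI impI)
      fix u v assume uv: "u \<le> t" "t \<le> v" "{u..v} \<subseteq> ball t r"
      then have "u \<in> ball t r" "v \<in> ball t r" by (meson atLeastAtMost_iff order_refl order_trans subsetD)+
      then have "norm (u - t) < r" "norm (v - t) < r" by (auto simp: dist_norm norm_minus_commute)
      from r(2)[OF this(1)] r(2)[OF this(2)] uv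
      have "D * (v - u) - e * (v - u) \<le> g v - g u"
        by (simp add: abs_if algebra_simps split: if_splits)
      moreover have "c * (v - u) \<le> D * (v - u)" using D uv by (intro mult_right_mono) auto
      ultimately show "(c - e) * (v - u) \<le> g v - g u" by (simp add: algebra_simps)
    qed (use r in auto)
  qed
  then obtain r where r: "\<And>t. t \<notin> E \<Longrightarrow> a \<le> t \<Longrightarrow> t \<le> b \<Longrightarrow> r t > 0"
    "\<And>t u v. t \<notin> E \<Longrightarrow> a \<le> t \<Longrightarrow> t \<le> b \<Longrightarrow> u \<le> t \<Longrightarrow> t \<le> v \<Longrightarrow> {u..v} \<subseteq> ball t (r t) \<Longrightarrow> (c - e) * (v - u) \<le> g v - g u"
    by metis
  define \<gamma> where "\<gamma> t = (if t \<in> E then U else if a \<le> t \<and> t \<le> b then ball t (r t) else UNIV)" for t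
  have "gauge \<gamma>" using U r(1) by (auto simp: gauge_def \<gamma>_def)
  then obtain p where p: "p tagged_division_of {a..b}" "\<gamma> fine p"
    using fine_division_exists_real by blast
  note pD = tagged_division_ofD[OF p(1)]
  have K: "\<exists>u v. K = {u..v} \<and> u \<le> t \<and> t \<le> v \<and> a \<le> u \<and> v \<le> b" if tK: "(t, K) \<in> p" for t K
  proof -
    obtain u v where "K = cbox u v" using pD(4)[OF tK] by blast
    moreover have "t \<in> K" "K \<subseteq> {a..b}" using pD(2,3)[OF tK] by auto
    ultimately show ?thesis by auto
  qed
  define B where "B = {(t, K) \<in> p. t \<in> E}"
  have B: "finite B" "B \<subseteq> p" using pD(1) by (auto simp: B_def intro: finite_subset)
  \<comment> \<open>Absolute continuity speaks of sets of endpoint pairs, so the tags are forgotten. Distinct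
    tagged intervals can have the same endpoints only if both are degenerate, so sums of increments
    are unaffected.\<close>
  define h where "h = (\<lambda>(t :: real, K :: real set). (Inf K, Sup K))"
  define D where "D = h ` B"
  have KD: "\<exists>t. (t, {u..v}) \<in> B \<and> u \<le> v \<and> a \<le> u \<and> v \<le> b \<and> {u..v} \<subseteq> U" if uv: "(u, v) \<in> D" for u v
  proof -
    obtain t K where tK: "(t, K) \<in> B" "u = Inf K" "v = Sup K" using uv by (auto simp: D_def h_def)
    have "K \<subseteq> \<gamma> t" "t \<in> E" using p(2) tK(1) by (auto simp: fine_def B_def)
    then have "K \<subseteq> U" by (simp add: \<gamma>_def)
    moreover have "(t, K) \<in> p" using tK B by auto
    ultimately show ?thesis using tK K[of t K] by auto
  qed
  have D: "finite D" "\<forall>(s, t) \<in> D. s \<le> t \<and> {s..t} \<subseteq> {a..b}"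
    using B(1) KD by (auto simp: D_def) (force+)
  have disj: "disjoint_family_on (\<lambda>(s, t). {s<..<t}) D"
    unfolding disjoint_family_on_def
  proof (intro ballI impI)
    fix m n assume mn: "m \<in> D" "n \<in> D" "m \<noteq> n"
    obtain s t s' t' where st: "m = (s, t)" "n = (s', t')" by (metis surj_pair)
    obtain x x' where x: "(x, {s..t}) \<in> p" "(x', {s'..t'}) \<in> p" "s \<le> t" "s' \<le> t'"
      using KD[of s t] KD[of s' t'] mn(1,2) B(2) by (auto simp: st)
    have "interior {s..t} \<inter> interior {s'..t'} = {}"
      using x mn(3) st by (intro pD(5)) (auto simp: Icc_eq_Icc)
    then show "(case m of (s, t) \<Rightarrow> {s<..<t}) \<inter> (case n of (s, t) \<Rightarrow> {s<..<t}) = {}"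
      by (simp add: st)
  qed
  have len: "(\<Sum>(s, t)\<in>D. t - s) < d'"
  proof (rule le_less_trans[OF sum_lengths_le_measure[OF D(1) _ disj _ U(3)] U(4)])
    fix s t assume "(s, t) \<in> D"
    from KD[OF this] show "s \<le> t" "{s<..<t} \<subseteq> U" by (auto dest: greaterThanLessThan_subseteq_atLeastAtMost_iff[THEN iffD2])
  qed
  have reindex: "(\<Sum>(t, K)\<in>B. F (Inf K) (Sup K)) = (\<Sum>(u, v)\<in>D. F u v)"
    if F: "\<And>u. F u u = 0" for F :: "real \<Rightarrow> real \<Rightarrow> real"
  proof -
    have "(\<Sum>(u, v)\<in>D. F u v) = sum ((\<lambda>(u, v). F u v) \<circ> h) B"
      unfolding D_def
    proof (rule sum.reindex_nontrivial[OF B(1)])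
      fix y y' assume y: "y \<in> B" "y' \<in> B" "y \<noteq> y'" "h y = h y'"
      obtain t K t' K' where y': "y = (t, K)" "y' = (t', K')" by (metis surj_pair)
      then have "(t, K) \<in> p" "(t', K') \<in> p" using y B by auto
      from K[OF this(1)] K[OF this(2)]
      obtain u v u' v' where uv: "K = {u..v}" "K' = {u'..v'}" "u \<le> v" "u' \<le> v'"
        using order_trans by blast
      with y y' have eq: "u' = u" "v' = v" by (auto simp: h_def)
      have "interior K \<inter> interior K' = {}" using y y' B by (intro pD(5)[of t _ t']) auto
      then have "u = v" using uv eq by auto
      then show "(\<lambda>(u, v). F u v) (h y) = 0" using uv F by (simp add: y' h_def)
    qed
    then show ?thesis by (simp add: h_def comp_def case_prod_unfold)
  qed
  have small: "(\<Sum>(s, t)\<in>D. \<bar>g t - g s\<bar>) < e"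
    using acd[OF D disj] len by (simp add: d'_def)
  have "- (2 * e) \<le> (\<Sum>(s, t)\<in>D. (g t - g s) - (c - e) * (t - s))"
  proof -
    have "(c - e) * (\<Sum>(s, t)\<in>D. t - s) \<le> \<bar>c - e\<bar> * (\<Sum>(s, t)\<in>D. t - s)"
      using D(2) by (intro mult_right_mono sum_nonneg) auto
    also have "\<dots> \<le> \<bar>c - e\<bar> * (e / (1 + \<bar>c - e\<bar>))"
      using len by (intro mult_left_mono) (auto simp: d'_def)
    also have "\<dots> \<le> e" using e by (simp add: field_simps)
    finally have "(c - e) * (\<Sum>(s, t)\<in>D. t - s) \<le> e" .
    moreover have "- e \<le> (\<Sum>(s, t)\<in>D. g t - g s)"
      using small sum_abs[of "\<lambda>x. g (snd x) - g (fst x)" D] unfolding case_prod_unfold by linarith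
    ultimately show ?thesis
      by (simp add: case_prod_unfold sum_subtractf flip: sum_distrib_left)
  qed
  also have "\<dots> = (\<Sum>(t, K)\<in>B. (g (Sup K) - g (Inf K)) - (c - e) * (Sup K - Inf K))"
    using reindex[of "\<lambda>s t. (g t - g s) - (c - e) * (t - s)"] by simp
  also have "\<dots> \<le> (\<Sum>(t, K)\<in>p. (g (Sup K) - g (Inf K)) - (c - e) * (Sup K - Inf K))"
  proof (rule sum_mono2[OF pD(1) B(2)])
    fix y assume y: "y \<in> p - B"
    obtain t K where tK: "y = (t, K)" by (metis surj_pair)
    then obtain u v where uv: "K = {u..v}" "u \<le> t" "t \<le> v" "a \<le> u" "v \<le> b"
      using K y by blast
    have "t \<notin> E" using y tK by (auto simp: B_def)
    moreover have "K \<subseteq> \<gamma> t" using p(2) y tK by (auto simp: fine_def)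
    ultimately have "(c - e) * (v - u) \<le> g v - g u"
      using uv by (intro r(2)[of t]) (auto simp: \<gamma>_def)
    then show "0 \<le> (case y of (t, K) \<Rightarrow> (g (Sup K) - g (Inf K)) - (c - e) * (Sup K - Inf K))"
      using uv tK by simp
  qed
  also have "\<dots> = (g b - g a) - (c - e) * (b - a)"
    using additive_tagged_division_1[OF ab p(1), of g] additive_tagged_division_1[OF ab p(1), of "\<lambda>x. x"]
    by (simp add: case_prod_unfold sum_subtractf flip: sum_distrib_left)
  finally show "c * (b - a) \<le> g b - g a + e0"
    by (simp add: e0 algebra_simps)
qed

lemma abs_continuous_on_imp_continuous_on:
  fixes z :: "real \<Rightarrow> 'a::real_normed_vector"
  assumes "abs_continuous_on {a..b} z"
  shows "continuous_on {a..b} z"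
  unfolding continuous_on_iff
proof (intro ballI allI impI)
  fix s e :: real assume s: "s \<in> {a..b}" and e: "e > 0"
  obtain d where d: "d > 0" and acd: "\<And>D. finite D \<Longrightarrow> (\<forall>(s, t) \<in> D. s \<le> t \<and> {s..t} \<subseteq> {a..b}) \<Longrightarrow>
       disjoint_family_on (\<lambda>(s, t). {s<..<t}) D \<Longrightarrow> (\<Sum>(s, t)\<in>D. t - s) < d
       \<Longrightarrow> (\<Sum>(s, t)\<in>D. norm (z t - z s)) < e"
    using assms e unfolding abs_continuous_on_def by meson
  show "\<exists>d>0. \<forall>t\<in>{a..b}. dist t s < d \<longrightarrow> dist (z t) (z s) < e"
  proof (intro exI[of _ d] conjI d ballI impI)
    fix t assume t: "t \<in> {a..b}" "dist t s < d"
    then have "norm (z (max s t) - z (min s t)) < e"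
      using acd[of "{(min s t, max s t)}"] s
      by (auto simp: disjoint_family_on_def dist_real_def)
    then show "dist (z t) (z s) < e"
      by (cases "s \<le> t") (auto simp: dist_norm norm_minus_commute max_def min_def)
  qed
qed

lemma abs_continuous_on_Lipschitz_compose:
  assumes z: "abs_continuous_on S z" and F: "L-lipschitz_on (z ` S) F"
  shows "abs_continuous_on S (F \<circ> z)"
  unfolding abs_continuous_on_def
proof (intro allI impI)
  fix e :: real assume "e > 0"
  have L: "L \<ge> 0" using F by (rule lipschitz_on_nonneg)
  have "e / (L + 1) > 0" using \<open>e > 0\<close> L by simp
  then obtain d where d: "d > 0" and acd: "\<And>D. finite D \<Longrightarrow> (\<forall>(s, t) \<in> D. s \<le> t \<and> {s..t} \<subseteq> S) \<Longrightarrow>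
       disjoint_family_on (\<lambda>(s, t). {s<..<t}) D \<Longrightarrow> (\<Sum>(s, t)\<in>D. t - s) < d
       \<Longrightarrow> (\<Sum>(s, t)\<in>D. norm (z t - z s)) < e / (L + 1)"
    using z unfolding abs_continuous_on_def by meson
  show "\<exists>d>0. \<forall>D. finite D \<and> (\<forall>(s, t) \<in> D. s \<le> t \<and> {s..t} \<subseteq> S) \<and>
       disjoint_family_on (\<lambda>(s, t). {s<..<t}) D \<and> (\<Sum>(s, t)\<in>D. t - s) < d
       \<longrightarrow> (\<Sum>(s, t)\<in>D. norm ((F \<circ> z) t - (F \<circ> z) s)) < e"
  proof (intro exI[of _ d] conjI d allI impI, elim conjE)
    fix D assume D: "finite D" "\<forall>(s, t) \<in> D. s \<le> t \<and> {s..t} \<subseteq> S"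
       "disjoint_family_on (\<lambda>(s, t). {s<..<t}) D" "(\<Sum>(s, t)\<in>D. t - s) < d"
    have "norm ((F \<circ> z) t - (F \<circ> z) s) \<le> L * norm (z t - z s)" if "(s, t) \<in> D" for s t
      using lipschitz_on_normD[OF F, of "z t" "z s"] D(2) that by force
    then have "(\<Sum>(s, t)\<in>D. norm ((F \<circ> z) t - (F \<circ> z) s)) \<le> (\<Sum>(s, t)\<in>D. L * norm (z t - z s))"
      by (intro sum_mono) auto
    also have "\<dots> = L * (\<Sum>(s, t)\<in>D. norm (z t - z s))"
      by (simp add: case_prod_unfold sum_distrib_left)
    also have "\<dots> \<le> (L + 1) * (\<Sum>(s, t)\<in>D. norm (z t - z s))"
      by (intro mult_right_mono sum_nonneg) auto
    also have "\<dots> < (L + 1) * (e / (L + 1))"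
      using acd[OF D] L by (intro mult_strict_left_mono) auto
    also have "\<dots> = e" using L by simp
    finally show "(\<Sum>(s, t)\<in>D. norm ((F \<circ> z) t - (F \<circ> z) s)) < e" .
  qed
qed

lemma abs_continuous_on_subset:
  assumes "abs_continuous_on T z" "S \<subseteq> T"
  shows "abs_continuous_on S z"
proof -
  have *: "\<forall>(s, t)\<in>D. s \<le> t \<and> {s..t} \<subseteq> T" if "\<forall>(s, t)\<in>D. s \<le> t \<and> {s..t} \<subseteq> S"
    for D :: "(real \<times> real) set"
    using that assms(2) by fastforce
  show ?thesis
    unfolding abs_continuous_on_def
  proof (intro allI impI)
    fix e :: real assume "e > 0"
    with assms(1) obtain d where "d > 0" and d: "\<forall>D. finite D \<and> (\<forall>(s, t) \<in> D. s \<le> t \<and> {s..t} \<subseteq> T) \<and>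
       disjoint_family_on (\<lambda>(s, t). {s<..<t}) D \<and> (\<Sum>(s, t)\<in>D. t - s) < d
       \<longrightarrow> (\<Sum>(s, t)\<in>D. norm (z t - z s)) < e"
      unfolding abs_continuous_on_def by blast
    show "\<exists>d>0. \<forall>D. finite D \<and> (\<forall>(s, t) \<in> D. s \<le> t \<and> {s..t} \<subseteq> S) \<and>
       disjoint_family_on (\<lambda>(s, t). {s<..<t}) D \<and> (\<Sum>(s, t)\<in>D. t - s) < d
       \<longrightarrow> (\<Sum>(s, t)\<in>D. norm (z t - z s)) < e"
    proof (intro exI[of _ d] conjI \<open>d > 0\<close> allI impI, elim conjE)
      fix D :: "(real \<times> real) set"
      assume D: "finite D" "\<forall>(s, t) \<in> D. s \<le> t \<and> {s..t} \<subseteq> S"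
        "disjoint_family_on (\<lambda>(s, t). {s<..<t}) D" "(\<Sum>(s, t)\<in>D. t - s) < d"
      show "(\<Sum>(s, t)\<in>D. norm (z t - z s)) < e"
        by (rule d[rule_format, OF conjI[OF D(1) conjI[OF *[OF D(2)] conjI[OF D(3,4)]]]])
    qed
  qed
qed

section \<open>Upper semicontinuity of the Clarke subdifferential\<close>

lemma clarke_dir_deriv_le_Lipschitz:
  assumes "u > 0" and f: "L-lipschitz_on (cball x u) f"
  shows "clarke_dir_deriv f x d \<le> ereal (L * norm d)"
  unfolding clarke_dir_deriv_def
proof (rule Limsup_bounded)
  have 1: "\<forall>\<^sub>F y in nhds x. dist y x < u / 2"
    using \<open>u > 0\<close> by (auto simp: eventually_nhds_metric intro!: exI[of _ "u/2"])
  have "((\<lambda>h. norm (h *\<^sub>R d)) \<longlongrightarrow> norm (0 *\<^sub>R d)) (at_right (0::real))"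
    by (intro tendsto_intros)
  then have "\<forall>\<^sub>F h in at_right (0::real). norm (h *\<^sub>R d) < u / 2"
    using \<open>u > 0\<close> by (intro order_tendstoD) auto
  then have 2: "\<forall>\<^sub>F h in at_right (0::real). norm (h *\<^sub>R d) < u / 2 \<and> 0 < h"
    using eventually_at_right_less[of "0::real"] by (rule eventually_conj)
  show "\<forall>\<^sub>F p in nhds x \<times>\<^sub>F at_right 0. (case p of (y, h) \<Rightarrow> ereal ((f (y + h *\<^sub>R d) - f y) / h)) \<le> ereal (L * norm d)"
    unfolding eventually_prod_filter
  proof (intro exI conjI, rule 1, rule 2, intro allI impI)
    fix y h assume y: "dist y x < u / 2" and h: "norm (h *\<^sub>R d) < u / 2 \<and> 0 < h"
    have "dist x (y + h *\<^sub>R d) \<le> dist x y + dist y (y + h *\<^sub>R d)" by (rule dist_triangle)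
    then have "y \<in> cball x u" "y + h *\<^sub>R d \<in> cball x u"
      using y h \<open>u > 0\<close> by (auto simp: dist_commute dist_norm)
    then have "norm (f (y + h *\<^sub>R d) - f y) \<le> L * norm (h *\<^sub>R d)"
      using lipschitz_on_normD[OF f, of "y + h *\<^sub>R d" y] by simp
    then have "f (y + h *\<^sub>R d) - f y \<le> L * norm d * h"
      using h by (simp add: algebra_simps)
    then show "(case (y, h) of (y, h) \<Rightarrow> ereal ((f (y + h *\<^sub>R d) - f y) / h)) \<le> ereal (L * norm d)"
      using h by (simp add: divide_le_eq)
  qed
qed

lemma clarke_subdiff_norm_le:
  assumes "u > 0" and "L-lipschitz_on (cball x u) f" and "v \<in> clarke_subdiff f x"
  shows "norm v \<le> L"
proof -
  have "ereal (v \<bullet> v) \<le> ereal (L * norm v)"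
    using assms(3) clarke_dir_deriv_le_Lipschitz[OF assms(1,2), of v]
    unfolding clarke_subdiff_def by (blast intro: order_trans)
  then have "norm v * norm v \<le> L * norm v" by (simp add: power2_norm_eq_inner flip: power2_eq_square)
  then show ?thesis using lipschitz_on_nonneg[OF assms(2)]
    by (cases "v = 0") auto
qed

lemma clarke_dir_deriv_upper_semicontinuous:
  assumes "clarke_dir_deriv f x d < r"
  shows "\<forall>\<^sub>F y in nhds x. clarke_dir_deriv f y d \<le> r"
proof -
  obtain P Q where PQ: "eventually P (nhds x)" "eventually Q (at_right (0::real))"
    "\<And>y h. P y \<Longrightarrow> Q h \<Longrightarrow> ereal ((f (y + h *\<^sub>R d) - f y) / h) < r"
    using Limsup_lessD[OF assms[unfolded clarke_dir_deriv_def]] unfolding eventually_prod_filter by auto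
  from PQ(1) have "\<forall>\<^sub>F y in nhds x. eventually P (nhds y)" by (simp add: eventually_eventually)
  then show ?thesis
  proof eventually_elim
    case (elim y)
    show ?case unfolding clarke_dir_deriv_def
      by (rule Limsup_bounded, unfold eventually_prod_filter, rule exI[of _ P], rule exI[of _ Q])
        (use elim PQ in \<open>auto intro: less_imp_le\<close>)
  qed
qed

text \<open>
  The Clarke directional derivative is an upper limit over all base points near \<open>x\<close>, hence upper
  semicontinuous in \<open>x\<close>; each inequality that defines the subdifferential survives in the limit.
\<close>

lemma clarke_subdiff_closed_graph:
  assumes y: "y \<longlonglongrightarrow> x" and v: "v \<longlonglongrightarrow> w" and mem: "\<And>k. v k \<in> clarke_subdiff f (y k)"
  shows "w \<in> clarke_subdiff f x"
proof -
  have "ereal (w \<bullet> d) \<le> clarke_dir_deriv f x d" for d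
  proof (rule dense_ge)
    fix r assume "clarke_dir_deriv f x d < r"
    then have "\<forall>\<^sub>F y in nhds x. clarke_dir_deriv f y d \<le> r"
      by (rule clarke_dir_deriv_upper_semicontinuous)
    with y have "\<forall>\<^sub>F k in sequentially. clarke_dir_deriv f (y k) d \<le> r"
      unfolding filterlim_iff by blast
    then have "\<forall>\<^sub>F k in sequentially. ereal (v k \<bullet> d) \<le> r"
      by eventually_elim (use mem in \<open>auto simp: clarke_subdiff_def intro: order_trans\<close>)
    moreover have "(\<lambda>k. ereal (v k \<bullet> d)) \<longlonglongrightarrow> ereal (w \<bullet> d)"
      using v by (intro tendsto_intros) auto
    ultimately show "ereal (w \<bullet> d) \<le> r"
      by (intro tendsto_upperbound) auto
  qed
  then show ?thesis by (simp add: clarke_subdiff_def)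
qed

lemma convex_clarke_subdiff: "convex (clarke_subdiff f x)"
proof -
  have "convex {v. ereal (v \<bullet> d) \<le> e}" for d :: 'a and e
    by (cases e) (auto simp: inner_commute[of _ d] convex_halfspace_le)
  moreover have "clarke_subdiff f x = (\<Inter>d. {v. ereal (v \<bullet> d) \<le> clarke_dir_deriv f x d})"
    by (auto simp: clarke_subdiff_def)
  ultimately show ?thesis by (auto intro: convex_INT)
qed

lemma compact_clarke_subdiff:
  fixes f :: "'a::euclidean_space \<Rightarrow> real"
  assumes "locally_lipschitz f"
  shows "compact (clarke_subdiff f x)"
proof (rule compact_eq_bounded_closed[THEN iffD2], rule conjI)
  obtain u L where "u > 0" "L-lipschitz_on (cball x u) f"
    using assms unfolding locally_lipschitz_def by blast
  then show "bounded (clarke_subdiff f x)"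
    unfolding bounded_iff by (blast intro: clarke_subdiff_norm_le)
  show "closed (clarke_subdiff f x)"
    unfolding closed_sequential_limits
    by (blast intro: clarke_subdiff_closed_graph[OF tendsto_const])
qed

text \<open>
  Otherwise subgradients in the complementary closed half-space exist at points converging to
  \<open>x\<close>. The local Lipschitz constant bounds them, and a cluster point is a subgradient at \<open>x\<close> by
  the closed graph property.
\<close>

lemma clarke_subdiff_halfspace_nearby:
  fixes f :: "'a::euclidean_space \<Rightarrow> real"
  assumes f: "locally_lipschitz f" and lt: "\<And>v. v \<in> clarke_subdiff f x \<Longrightarrow> v \<bullet> d < c"
  shows "\<forall>\<^sub>F y in nhds x. \<forall>v\<in>clarke_subdiff f y. v \<bullet> d < c"
proof (rule ccontr)
  assume neg: "\<not> (\<forall>\<^sub>F y in nhds x. \<forall>v\<in>clarke_subdiff f y. v \<bullet> d < c)"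
  obtain u L where uL: "u > 0" "L-lipschitz_on (cball x u) f"
    using f unfolding locally_lipschitz_def by blast
  \<comment> \<open>Half the radius, so that the same Lipschitz constant is valid on a ball around each \<open>y\<close>.\<close>
  have "\<exists>y v. dist y x < min (u/2) (1 / Suc k) \<and> v \<in> clarke_subdiff f y \<and> c \<le> v \<bullet> d" for k :: nat
  proof -
    have "\<not> (\<forall>y. dist y x < min (u/2) (1 / Suc k) \<longrightarrow> (\<forall>v\<in>clarke_subdiff f y. v \<bullet> d < c))"
      using neg uL(1) unfolding eventually_nhds_metric by (metis min_less_iff_conj half_gt_zero zero_less_divide_1_iff of_nat_0_less_iff zero_less_Suc)
    then show ?thesis by (auto simp: not_less)
  qed
  then obtain y v where yv: "\<And>k. dist (y k) x < min (u/2) (1 / Suc k)" "\<And>k. v k \<in> clarke_subdiff f (y k)"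
    "\<And>k. c \<le> v k \<bullet> d" by metis
  have y: "y \<longlonglongrightarrow> x"
  proof (rule metric_LIMSEQ_I)
    fix r :: real assume "r > 0"
    then obtain n where "inverse (real (Suc n)) < r" using reals_Archimedean by blast
    moreover have "1 / real (Suc k) \<le> inverse (real (Suc n))" if "k \<ge> n" for k
      using that by (simp add: field_simps)
    ultimately show "\<exists>n0. \<forall>k\<ge>n0. dist (y k) x < r"
      using yv(1) by (intro exI[of _ n]) (force intro: less_trans)
  qed
  have "norm (v k) \<le> L" for k
  proof (rule clarke_subdiff_norm_le[OF _ _ yv(2)])
    have "cball (y k) (u/2) \<subseteq> cball x u"
    proof
      fix z assume "z \<in> cball (y k) (u/2)"
      then show "z \<in> cball x u" using yv(1)[of k] dist_triangle[of x z "y k"] by (simp add: dist_commute)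
    qed
    then show "L-lipschitz_on (cball (y k) (u/2)) f" using uL(2) lipschitz_on_subset by blast
  qed (use uL in simp)
  then have "\<forall>k. v k \<in> cball 0 L" by simp
  then obtain w r where r: "strict_mono (r :: nat \<Rightarrow> nat)" "(v \<circ> r) \<longlonglongrightarrow> w"
    using compact_cball[of "0::'a" L] unfolding compact_eq_seq_compact_metric seq_compact_def by blast
  have "w \<in> clarke_subdiff f x"
    by (rule clarke_subdiff_closed_graph[OF LIMSEQ_subseq_LIMSEQ[OF y r(1)] r(2)]) (simp add: yv)
  moreover have "c \<le> w \<bullet> d"
  proof (rule tendsto_lowerbound)
    show "(\<lambda>k. (v \<circ> r) k \<bullet> d) \<longlonglongrightarrow> w \<bullet> d" using r(2) by (intro tendsto_intros)
  qed (auto simp: yv)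
  ultimately show False using lt by fastforce
qed

section \<open>Separation at a non-stationary point\<close>

lemma inner_transpose_mult:
  fixes A :: "real ^ 'n ^ 'm"
  shows "d \<bullet> (transpose A *v y) = (A *v d) \<bullet> y"
  by (simp add: inner_commute[of d] inner_commute[of _ y] dot_lmul_matrix)

lemma closure_pos_orthant_nonneg:
  fixes y :: "real ^ 'n"
  assumes "y \<in> closure pos_orthant"
  shows "0 \<le> y $ i"
proof -
  have "closure pos_orthant \<subseteq> {y :: real ^ 'n. 0 \<le> y $ i}"
    by (intro closure_minimal closed_Collect_le continuous_intros) (auto simp: pos_orthant_def less_imp_le)
  then show ?thesis using assms by blast
qed

lemma normal_cone_orthantI:
  fixes xbar u :: "real ^ 'n"
  assumes "xbar \<in> closure pos_orthant"
    and "\<And>i. u $ i \<le> 0" and "\<And>i. xbar $ i \<noteq> 0 \<Longrightarrow> u $ i = 0"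
  shows "u \<in> normal_cone (closure pos_orthant) xbar"
proof -
  have "u $ i * (y $ i - xbar $ i) \<le> 0" if "y \<in> closure pos_orthant" for y i
    using assms(2,3)[of i] closure_pos_orthant_nonneg[OF that, of i]
    by (cases "xbar $ i = 0") (auto simp: mult_nonpos_nonneg)
  then show ?thesis
    using assms(1) by (auto simp: normal_cone_def inner_vec_def intro!: sum_nonpos)
qed

text \<open>
  Non-stationarity says that \<open>- \<partial>f(xbar)\<close> does not meet \<open>range A\<^sup>T + N(xbar)\<close>. That cone is finitely
  generated, by plus and minus the rows of \<open>A\<close> and by \<open>- e\<^sub>i\<close> for the vanishing coordinates of
  \<open>xbar\<close>, hence polyhedral and closed, and it can be strictly separated from a compact convex
  set. A linear functional bounded above on a cone is nonpositive on it; evaluating at the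
  generators gives the two sign conditions on \<open>d\<close>.
\<close>

lemma descent_direction:
  fixes f :: "real ^ 'n \<Rightarrow> real" and A :: "real ^ 'n ^ 'm"
  assumes f: "locally_lipschitz f"
    and xbar: "xbar \<in> affine_set A b \<inter> closure pos_orthant" "xbar \<notin> stationary_set f A b"
  obtains d c where "A *v d = 0" "\<And>i. xbar $ i = 0 \<Longrightarrow> 0 \<le> d $ i" "0 < c"
    "\<And>v. v \<in> clarke_subdiff f xbar \<Longrightarrow> v \<bullet> d < - c"
proof (cases "clarke_subdiff f xbar = {}")
  \<comment> \<open>Strict separation needs nonempty sets; without subgradients the zero direction will do.\<close>
  case True
  then show ?thesis using that[of 0 1] by simp
next
  case False
  define G where "G = range (\<lambda>k. transpose A *v axis k 1) \<union> range (\<lambda>k. - (transpose A *v axis k 1))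
    \<union> (\<lambda>i. - axis i 1) ` {i. xbar $ i = 0}"
  define K where "K = convex_cone hull G"
  have GK: "g \<in> K" if "g \<in> G" for g using that hull_subset[of G convex_cone] by (auto simp: K_def)
  have "finite G" by (simp add: G_def)
  then have "closed K" unfolding K_def by (intro polyhedron_imp_closed polyhedron_convex_cone_hull)
  define N where "N = {u :: real ^ 'n. (\<forall>i. u $ i \<le> 0) \<and> (\<forall>i. xbar $ i \<noteq> 0 \<longrightarrow> u $ i = 0)}"
  have KN: "\<exists>y. \<exists>u\<in>N. w = transpose A *v y + u" if "w \<in> K" for w
  proof -
    have "K \<subseteq> {w. \<exists>y. \<exists>u\<in>N. w = transpose A *v y + u}"
      unfolding K_def
    proof (rule hull_minimal)
      have gen: "transpose A *v y + u \<in> {w. \<exists>y. \<exists>u\<in>N. w = transpose A *v y + u}" if "u \<in> N" for y u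
        using that by blast
      show "G \<subseteq> {w. \<exists>y. \<exists>u\<in>N. w = transpose A *v y + u}"
      proof
        fix g assume "g \<in> G"
        then consider k where "g = transpose A *v axis k 1" | k where "g = - (transpose A *v axis k 1)"
          | i where "g = - axis i 1" "xbar $ i = 0"
          by (auto simp: G_def)
        then show "g \<in> {w. \<exists>y. \<exists>u\<in>N. w = transpose A *v y + u}"
        proof cases
          case 1 then show ?thesis using gen[of 0] by (force simp: N_def)
        next
          case (2 k) then show ?thesis using gen[of 0 "- axis k 1"]
            by (simp add: N_def vec.neg)
        next
          case 3 then show ?thesis using gen[of g 0] by (simp add: N_def axis_def)
        qed
      qed
      show "convex_cone {w. \<exists>y. \<exists>u\<in>N. w = transpose A *v y + u}"
        unfolding convex_cone_iff
      proof (intro conjI ballI allI impI)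
        show "0 \<in> {w. \<exists>y. \<exists>u\<in>N. w = transpose A *v y + u}"
          using gen[of 0 0] by (simp add: N_def)
      next
        fix w w' assume "w \<in> {w. \<exists>y. \<exists>u\<in>N. w = transpose A *v y + u}" "w' \<in> {w. \<exists>y. \<exists>u\<in>N. w = transpose A *v y + u}"
        then obtain y u y' u' where "u \<in> N" "u' \<in> N" "w = transpose A *v y + u" "w' = transpose A *v y' + u'" by blast
        then show "w + w' \<in> {w. \<exists>y. \<exists>u\<in>N. w = transpose A *v y + u}"
          using gen[of "u + u'" "y + y'"] by (simp add: N_def matrix_vector_right_distrib add_nonpos_nonpos add_ac del: transpose_matrix_vector)
      next
        fix w and c :: real assume "w \<in> {w. \<exists>y. \<exists>u\<in>N. w = transpose A *v y + u}" "0 \<le> c"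
        then obtain y u where "u \<in> N" "w = transpose A *v y + u" by blast
        with \<open>0 \<le> c\<close> show "c *\<^sub>R w \<in> {w. \<exists>y. \<exists>u\<in>N. w = transpose A *v y + u}"
          using gen[of "c *\<^sub>R u" "c *\<^sub>R y"]
          by (simp add: N_def matrix_vector_mult_scaleR mult_nonneg_nonpos scaleR_right_distrib)
      qed
    qed
    then show ?thesis using that by blast
  qed
  have disj: "K \<inter> uminus ` clarke_subdiff f xbar = {}"
  proof (rule ccontr)
    assume "K \<inter> uminus ` clarke_subdiff f xbar \<noteq> {}"
    then obtain v where v: "v \<in> clarke_subdiff f xbar" "- v \<in> K" by blast
    then obtain y u where u: "u \<in> N" "- v = transpose A *v y + u" using KN by blast
    have "u \<in> normal_cone (closure pos_orthant) xbar"
      using xbar(1) u(1) by (intro normal_cone_orthantI) (auto simp: N_def)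
    moreover have "v + transpose A *v y + u = 0" using u(2) by (metis add.assoc add.right_inverse)
    ultimately show False using xbar v(1) unfolding stationary_set_def by blast
  qed
  obtain d c where d: "\<And>w. w \<in> K \<Longrightarrow> d \<bullet> w < c" and c: "\<And>v. v \<in> clarke_subdiff f xbar \<Longrightarrow> d \<bullet> (- v) > c"
    using separating_hyperplane_closed_compact[OF _ \<open>closed K\<close> _ _ _ disj] False
      compact_clarke_subdiff[OF f, of xbar] convex_clarke_subdiff[of f xbar]
    by (auto simp: K_def convex_convex_cone_hull convex_negations compact_negations)
  have "0 < c" using d[of 0] by (simp add: K_def convex_cone_hull_contains_0)
  have le0: "d \<bullet> w \<le> 0" if "w \<in> K" for w
  proof (rule ccontr)
    assume pos: "\<not> d \<bullet> w \<le> 0"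
    then have "(c / (d \<bullet> w)) *\<^sub>R w \<in> K"
      using that \<open>0 < c\<close> by (auto simp: K_def intro!: convex_cone_hull_mul)
    from d[OF this] show False using pos by simp
  qed
  show ?thesis
  proof (rule that[of d c])
    have "(A *v d) $ k = 0" for k
    proof -
      have "transpose A *v axis k 1 \<in> K" "- (transpose A *v axis k 1) \<in> K"
        by (auto intro!: GK simp: G_def)
      then have "d \<bullet> (transpose A *v axis k 1) = 0"
        using le0[of "transpose A *v axis k 1"] le0[of "- (transpose A *v axis k 1)"]
          \<open>transpose A *v axis k 1 \<in> K\<close> \<open>- (transpose A *v axis k 1) \<in> K\<close>
        unfolding inner_minus_right by linarith
      then show ?thesis by (simp add: inner_transpose_mult inner_axis del: transpose_matrix_vector)
    qed
    then show "A *v d = 0" by (simp add: vec_eq_iff)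
    show "0 \<le> d $ i" if "xbar $ i = 0" for i
      using le0[OF GK, of "- axis i 1"] that by (simp add: G_def inner_axis)
    show "v \<bullet> d < - c" if "v \<in> clarke_subdiff f xbar" for v
      using c[OF that] by (simp add: inner_commute)
  qed fact
qed

section \<open>The Hessian of a separable kernel\<close>

lemma open_pos_orthant: "open (pos_orthant :: (real ^ 'n) set)"
proof -
  have eq: "pos_orthant = (\<Inter>i. {x :: real ^ 'n. 0 < x $ i})" by (auto simp: pos_orthant_def)
  show ?thesis unfolding eq by (intro open_INT open_Collect_less continuous_intros finite ballI)
qed

lemma gradient_eqI:
  assumes "GDERIV g x :> D"
  shows "gradient g x = D"
  unfolding gradient_def
proof (rule the_equality)
  show "GDERIV g x :> D" by (rule assms)
next
  fix E assume "GDERIV g x :> E"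
  then have "(\<lambda>h. h \<bullet> E) = (\<lambda>h. h \<bullet> D)"
    using assms unfolding gderiv_def by (rule has_derivative_unique)
  then show "E = D" by (metis vector_eq_ldot)
qed

lemma gradient_separable:
  fixes x :: "real ^ 'n"
  assumes "\<And>i. \<phi> i differentiable (at (x $ i))"
  shows "gradient (separable \<phi>) x = (\<chi> i. deriv (\<phi> i) (x $ i))"
proof (rule gradient_eqI, unfold gderiv_def)
  have "((\<lambda>y. \<Sum>i\<in>UNIV. \<phi> i (y $ i)) has_derivative (\<lambda>h. \<Sum>i\<in>UNIV. deriv (\<phi> i) (x $ i) * h $ i)) (at x)"
  proof (rule has_derivative_sum)
    fix i
    have "(\<phi> i has_derivative (*) (deriv (\<phi> i) (x $ i))) (at (x $ i))"
      using assms[of i] DERIV_deriv_iff_real_differentiable has_field_derivative_def by blast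
    then show "((\<lambda>y. \<phi> i (y $ i)) has_derivative (\<lambda>h. deriv (\<phi> i) (x $ i) * h $ i)) (at x)"
      by (rule has_derivative_compose[rotated]) (rule bounded_linear.has_derivative[OF bounded_linear_vec_nth has_derivative_ident])
  qed
  then show "(separable \<phi> has_derivative (\<lambda>h. h \<bullet> (\<chi> i. deriv (\<phi> i) (x $ i)))) (at x)"
    by (simp add: separable_def[abs_def] inner_vec_def mult.commute)
qed

lemma hessian_separable_mult:
  fixes x :: "real ^ 'n"
  assumes x: "x \<in> pos_orthant" and diff: "\<And>i t. 0 < t \<Longrightarrow> \<phi> i differentiable (at t)"
    and q: "\<And>i. (deriv (\<phi> i) has_real_derivative q i) (at (x $ i))"
  shows "hessian (separable \<phi>) x *v h = (\<chi> i. q i * h $ i)"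
proof -
  have "((\<lambda>y. \<chi> i. deriv (\<phi> i) (y $ i)) has_derivative (\<lambda>h. \<chi> i. q i * h $ i)) (at x)"
  proof (rule has_derivative_componentwise_within[THEN iffD2], rule ballI)
    fix e :: "real ^ 'n" assume "e \<in> Basis"
    then obtain i where e: "e = axis i 1" by (auto simp: Basis_vec_def)
    have "(deriv (\<phi> i) has_derivative (*) (q i)) (at (x $ i))"
      using q has_field_derivative_def by blast
    then have "((\<lambda>y. deriv (\<phi> i) (y $ i)) has_derivative (\<lambda>h. q i * h $ i)) (at x)"
      by (rule has_derivative_compose[rotated]) (rule bounded_linear.has_derivative[OF bounded_linear_vec_nth has_derivative_ident])
    then show "((\<lambda>y. (\<chi> i. deriv (\<phi> i) (y $ i)) \<bullet> e) has_derivative (\<lambda>h. (\<chi> i. q i * h $ i) \<bullet> e)) (at x)"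
      by (simp add: e inner_axis)
  qed
  then have "(gradient (separable \<phi>) has_derivative (\<lambda>h. \<chi> i. q i * h $ i)) (at x)"
    by (rule has_derivative_transform_within_open[OF _ open_pos_orthant x])
      (simp add: gradient_separable diff pos_orthant_def)
  then have "frechet_derivative (gradient (separable \<phi>)) (at x) = (\<lambda>h. \<chi> i. q i * h $ i)"
    "linear (\<lambda>h :: real ^ 'n. \<chi> i. q i * h $ i)"
    by (auto simp: frechet_derivative_at[symmetric] has_derivative_linear)
  then show ?thesis by (simp add: hessian_def jacobian_def matrix_works)
qed

text \<open>
  Writing \<open>P H\<^sup>-\<^sup>1 v = H\<^sup>-\<^sup>1 (v - A\<^sup>T y)\<close> for a suitable \<open>y\<close>, the Hessian cancels its inverse, and the term
  \<open>A\<^sup>T y\<close> is orthogonal to the kernel of \<open>A\<close>.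
\<close>

lemma inner_hessian_projected_gradient:
  fixes A :: "real ^ 'n ^ 'm" and x d v :: "real ^ 'n"
  assumes x: "x \<in> pos_orthant" and diff: "\<And>i t. 0 < t \<Longrightarrow> \<phi> i differentiable (at t)"
    and q: "\<And>i. (deriv (\<phi> i) has_real_derivative q i) (at (x $ i))" and q_pos: "\<And>i. 0 < q i"
    and d: "A *v d = 0"
  shows "(\<Sum>i\<in>UNIV. d $ i * (q i * ((metric_proj A (separable \<phi>) x ** inv_hessian (separable \<phi>) x) *v v) $ i)) = d \<bullet> v"
proof -
  define H where "H = hessian (separable \<phi>) x"
  have H: "H *v h = (\<chi> i. q i * h $ i)" for h
    unfolding H_def using x diff q by (rule hessian_separable_mult)
  have "inj ((*v) H)"
    using q_pos by (auto simp: inj_def H vec_eq_iff) (metis less_irrefl)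
  then have "invertible H" by (metis invertible_left_inverse matrix_left_invertible_injective)
  then have HH: "H ** matrix_inv H = mat 1"
    unfolding invertible_def matrix_inv_def by (rule someI2_ex) blast
  have inv: "inv_hessian (separable \<phi>) x = matrix_inv H" using x by (simp add: inv_hessian_def H_def)
  have HHv: "H *v (matrix_inv H *v w) = w" for w
    by (simp add: matrix_vector_mul_assoc HH)
  define y where "y = matrix_inv (A ** matrix_inv H ** transpose A) *v (A *v (matrix_inv H *v v))"
  have "(metric_proj A (separable \<phi>) x ** inv_hessian (separable \<phi>) x) *v v
    = matrix_inv H *v v - matrix_inv H *v (transpose A *v y)"
    by (simp add: metric_proj_def inv y_def matrix_vector_mult_diff_rdistrib flip: matrix_vector_mul_assoc)
  then have "H *v ((metric_proj A (separable \<phi>) x ** inv_hessian (separable \<phi>) x) *v v) = v - transpose A *v y"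
    by (simp add: matrix_vector_mult_diff_distrib HHv)
  then have "d \<bullet> (\<chi> i. q i * ((metric_proj A (separable \<phi>) x ** inv_hessian (separable \<phi>) x) *v v) $ i)
    = d \<bullet> v - d \<bullet> (transpose A *v y)"
    by (simp add: H inner_diff_right)
  also have "d \<bullet> (transpose A *v y) = 0"
    using d by (simp only: inner_transpose_mult inner_zero_left)
  finally show ?thesis by (simp add: inner_vec_def)
qed

text \<open>
  Makes \<open>\<langle>\<nabla>\<phi>(x(t)), d\<rangle>\<close> absolutely continuous on compact time intervals: although \<open>\<nabla>\<phi>\<close> blows up at
  the boundary of the orthant, a continuous curve inside the orthant keeps every coordinate in a
  compact subinterval of \<open>(0, \<infinity>)\<close> for a compact range of times.
\<close>

lemma Lipschitz_on_separable_sum: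
  fixes S :: "(real ^ 'n) set" and h :: "'n \<Rightarrow> real \<Rightarrow> real"
  assumes S: "compact S" "S \<subseteq> pos_orthant"
    and h: "\<And>i t. 0 < t \<Longrightarrow> (h i has_real_derivative q i t) (at t)"
    and q: "\<And>i. continuous_on {0<..} (q i)"
  shows "\<exists>L. L-lipschitz_on S (\<lambda>y. \<Sum>i\<in>UNIV. d $ i * h i (y $ i))"
proof (cases "S = {}")
  case True
  then show ?thesis by (intro exI[of _ 0]) (simp add: lipschitz_on_def)
next
  case False
  have "\<exists>B\<ge>0. \<forall>y\<in>S. \<forall>z\<in>S. \<bar>h i (y $ i) - h i (z $ i)\<bar> \<le> B * \<bar>y $ i - z $ i\<bar>" for i
  proof -
    have comp: "continuous_on S (\<lambda>y. y $ i)" by (intro continuous_intros)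
    obtain l where l: "l \<in> S" "\<And>y. y \<in> S \<Longrightarrow> l $ i \<le> y $ i"
      using continuous_attains_inf[OF S(1) False comp] by blast
    obtain m where m: "m \<in> S" "\<And>y. y \<in> S \<Longrightarrow> y $ i \<le> m $ i"
      using continuous_attains_sup[OF S(1) False comp] by blast
    have "0 < l $ i" using l S(2) by (auto simp: pos_orthant_def)
    then have sub: "{l $ i..m $ i} \<subseteq> {0<..}" by auto
    have "bounded (q i ` {l $ i..m $ i})"
      by (intro compact_imp_bounded compact_continuous_image continuous_on_subset[OF q sub] compact_Icc)
    then obtain B where B: "\<And>t. t \<in> {l $ i..m $ i} \<Longrightarrow> norm (q i t) \<le> B"
      unfolding bounded_iff by (meson imageI)
    have "norm (h i s - h i t) \<le> B * norm (s - t)" if "s \<in> {l $ i..m $ i}" "t \<in> {l $ i..m $ i}" for s t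
    proof (rule field_differentiable_bound[OF _ _ B that, where f = "h i"])
      fix r assume "r \<in> {l $ i..m $ i}"
      then show "(h i has_field_derivative q i r) (at r within {l $ i..m $ i})"
        using sub by (intro has_field_derivative_at_within[OF h]) auto
    qed auto
    moreover have "0 \<le> B" using norm_ge_zero[of "q i (l $ i)"] B[of "l $ i"] l m by force
    ultimately show ?thesis using l m by (intro exI[of _ B]) auto
  qed
  then obtain B where B: "\<And>i. 0 \<le> B i"
    "\<And>i y z. y \<in> S \<Longrightarrow> z \<in> S \<Longrightarrow> \<bar>h i (y $ i) - h i (z $ i)\<bar> \<le> B i * \<bar>y $ i - z $ i\<bar>"
    by metis
  show ?thesis
  proof (intro exI lipschitz_onI)
    show "0 \<le> (\<Sum>i\<in>UNIV. \<bar>d $ i\<bar> * B i)" by (intro sum_nonneg) (simp add: B)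
    fix y z assume yz: "y \<in> S" "z \<in> S"
    have "\<bar>\<Sum>i\<in>UNIV. d $ i * (h i (y $ i) - h i (z $ i))\<bar> \<le> (\<Sum>i\<in>UNIV. \<bar>d $ i * (h i (y $ i) - h i (z $ i))\<bar>)"
      by (rule sum_abs)
    also have "\<dots> \<le> (\<Sum>i\<in>UNIV. \<bar>d $ i\<bar> * B i * norm (y - z))"
    proof (rule sum_mono)
      fix i
      have "\<bar>h i (y $ i) - h i (z $ i)\<bar> \<le> B i * \<bar>y $ i - z $ i\<bar>" using B(2) yz .
      also have "\<dots> \<le> B i * norm (y - z)"
        using component_le_norm_cart[of "y - z" i] by (intro mult_left_mono) (simp_all add: B)
      finally show "\<bar>d $ i * (h i (y $ i) - h i (z $ i))\<bar> \<le> \<bar>d $ i\<bar> * B i * norm (y - z)"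
        by (simp add: abs_mult mult.assoc mult_left_mono)
    qed
    finally show "dist (\<Sum>i\<in>UNIV. d $ i * h i (y $ i)) (\<Sum>i\<in>UNIV. d $ i * h i (z $ i))
      \<le> (\<Sum>i\<in>UNIV. \<bar>d $ i\<bar> * B i) * dist y z"
      by (simp add: dist_norm sum_distrib_right right_diff_distrib flip: sum_subtractf)
  qed
qed

lemma separable_kernel_deriv:
  assumes "separable_kernel \<phi>"
  obtains q where "\<And>i t. 0 < t \<Longrightarrow> \<phi> i differentiable (at t)"
    "\<And>i t. 0 < t \<Longrightarrow> (deriv (\<phi> i) has_real_derivative q i t) (at t)"
    "\<And>i t. 0 < t \<Longrightarrow> 0 < q i t" "\<And>i. continuous_on {0<..} (q i)"
proof -
  obtain \<gamma> \<psi> where \<psi>: "\<And>i. continuous_on UNIV (\<psi> i)" "\<And>i t. 0 < (\<psi> i t :: real)"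
    "\<And>i t. 0 < t \<Longrightarrow> (deriv (\<phi> i) has_real_derivative (t powr (- \<gamma>) * \<psi> i t)) (at t)"
    using assms unfolding separable_kernel_def by metis
  show ?thesis
  proof (rule that[of "\<lambda>i t. t powr (- \<gamma>) * \<psi> i t"])
    show "continuous_on {0<..} (\<lambda>t. t powr (- \<gamma>) * \<psi> i t)" for i
      by (intro continuous_intros continuous_on_subset[OF \<psi>(1)]) auto
  qed (use assms \<psi> in \<open>auto simp: separable_kernel_def\<close>)
qed

lemma separable_kernel_deriv_mono:
  assumes "separable_kernel \<phi>" "0 < s" "s \<le> t"
  shows "deriv (\<phi> i) s \<le> deriv (\<phi> i) t"
proof -
  obtain q where q: "\<And>i t. 0 < t \<Longrightarrow> (deriv (\<phi> i) has_real_derivative q i t) (at t)"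
    "\<And>i t. 0 < t \<Longrightarrow> 0 < q i t"
    using separable_kernel_deriv[OF assms(1)] by metis
  show ?thesis
  proof (rule DERIV_nonneg_imp_nondecreasing[OF assms(3)])
    fix r assume "s \<le> r"
    then have "0 < r" using assms(2) by simp
    then show "\<exists>y. (deriv (\<phi> i) has_real_derivative y) (at r) \<and> 0 \<le> y"
      using q by (blast intro: less_imp_le)
  qed
qed


section \<open>The mirror variable along a trajectory\<close>

text \<open>
  By the chain rule and \<open>inner_hessian_projected_gradient\<close>, the derivative of
  \<open>\<langle>\<nabla>\<phi>(x(r)), d\<rangle>\<close> is \<open>- \<langle>v, d\<rangle> \<ge> c\<close> for almost every \<open>r\<close>, with \<open>v\<close> the subgradient that drives the
  trajectory at time \<open>r\<close>.
\<close>

lemma mirror_variable_growth: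
  fixes f :: "real ^ 'n \<Rightarrow> real" and A :: "real ^ 'n ^ 'm"
  assumes kernel: "separable_kernel \<phi>" and x: "is_trajectory f A b (separable \<phi>) x"
    and d: "A *v d = 0" and s: "0 \<le> s" "s \<le> t"
    and descent: "\<And>r v. s < r \<Longrightarrow> r < t \<Longrightarrow> v \<in> clarke_subdiff f (x r) \<Longrightarrow> v \<bullet> d \<le> - c"
  shows "c * (t - s) \<le> (\<Sum>i\<in>UNIV. d $ i * deriv (\<phi> i) (x t $ i)) - (\<Sum>i\<in>UNIV. d $ i * deriv (\<phi> i) (x s $ i))"
proof -
  obtain q where diff: "\<And>i t. 0 < t \<Longrightarrow> \<phi> i differentiable (at t)"
    and q: "\<And>i t. 0 < t \<Longrightarrow> (deriv (\<phi> i) has_real_derivative q i t) (at t)"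
    and q_pos: "\<And>i t. 0 < t \<Longrightarrow> 0 < q i t" and q_cont: "\<And>i. continuous_on {0<..} (q i)"
    using separable_kernel_deriv[OF kernel] by metis
  have pos: "x r \<in> pos_orthant" if "0 \<le> r" for r
    using x that unfolding is_trajectory_def by blast
  define F where "F = (\<lambda>y :: real ^ 'n. \<Sum>i\<in>UNIV. d $ i * deriv (\<phi> i) (y $ i))"
  have "abs_continuous_on {0..t} x"
    using x s unfolding is_trajectory_def abs_continuous_curve_def by simp
  then have ac: "abs_continuous_on {s..t} x"
    by (rule abs_continuous_on_subset) (use s in simp)
  have "compact (x ` {s..t})"
    by (intro compact_continuous_image abs_continuous_on_imp_continuous_on[OF ac] compact_Icc)
  moreover have "x ` {s..t} \<subseteq> pos_orthant" using pos s by auto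
  ultimately have "\<exists>L. L-lipschitz_on (x ` {s..t}) (\<lambda>y. \<Sum>i\<in>UNIV. d $ i * deriv (\<phi> i) (y $ i))"
    using q q_cont by (rule Lipschitz_on_separable_sum)
  then obtain L where "L-lipschitz_on (x ` {s..t}) F" unfolding F_def ..
  then have "abs_continuous_on {s..t} (F \<circ> x)"
    by (rule abs_continuous_on_Lipschitz_compose[OF ac])
  moreover have "AE r in lebesgue. s < r \<and> r < t \<longrightarrow> (\<exists>D\<ge>c. (F \<circ> x has_real_derivative D) (at r))"
  proof -
    have "AE r in lebesgue. 0 < r \<longrightarrow> (\<exists>v \<in> clarke_subdiff f (x r).
          (x has_vector_derivative
             - ((metric_proj A (separable \<phi>) (x r) ** inv_hessian (separable \<phi>) (x r)) *v v)) (at r))"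
      using x unfolding is_trajectory_def by blast
    then show ?thesis
    proof (rule AE_mp, intro AE_I2 impI, elim conjE)
      fix r assume "0 < r \<longrightarrow> (\<exists>v \<in> clarke_subdiff f (x r).
          (x has_vector_derivative
             - ((metric_proj A (separable \<phi>) (x r) ** inv_hessian (separable \<phi>) (x r)) *v v)) (at r))"
        and r: "s < r" "r < t"
      then obtain v where v: "v \<in> clarke_subdiff f (x r)"
        and dx: "(x has_vector_derivative
             - ((metric_proj A (separable \<phi>) (x r) ** inv_hessian (separable \<phi>) (x r)) *v v)) (at r)"
        using s by auto
      define w where "w = (metric_proj A (separable \<phi>) (x r) ** inv_hessian (separable \<phi>) (x r)) *v v"
      have xr: "x r \<in> pos_orthant" using pos s r by simp
      have "((\<lambda>r. d $ i * deriv (\<phi> i) (x r $ i)) has_real_derivative d $ i * (q i (x r $ i) * - w $ i)) (at r)" for i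
      proof -
        have "((\<lambda>r. x r $ i) has_vector_derivative (- w) $ i) (at r)"
          using bounded_linear.has_vector_derivative[OF bounded_linear_vec_nth dx] unfolding w_def .
        then have "((\<lambda>r. x r $ i) has_real_derivative - w $ i) (at r)"
          by (simp add: has_real_derivative_iff_has_vector_derivative)
        moreover have "(deriv (\<phi> i) has_real_derivative q i (x r $ i)) (at (x r $ i))"
          using q xr by (simp add: pos_orthant_def)
        ultimately have "((\<lambda>r. deriv (\<phi> i) (x r $ i)) has_real_derivative q i (x r $ i) * - w $ i) (at r)"
          by (rule DERIV_chain2[rotated])
        then show ?thesis by (rule DERIV_cmult)
      qed
      then have "(F \<circ> x has_real_derivative (\<Sum>i\<in>UNIV. d $ i * (q i (x r $ i) * - w $ i))) (at r)"
        unfolding F_def comp_def by (rule DERIV_sum)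
      moreover have "(\<Sum>i\<in>UNIV. d $ i * (q i (x r $ i) * - w $ i)) = - (d \<bullet> v)"
      proof -
        have "(\<Sum>i\<in>UNIV. d $ i * (q i (x r $ i) * w $ i)) = d \<bullet> v"
          unfolding w_def
          by (rule inner_hessian_projected_gradient[OF xr diff _ _ d])
            (use q q_pos xr in \<open>auto simp: pos_orthant_def\<close>)
        then show ?thesis by (simp add: sum_negf)
      qed
      moreover have "c \<le> - (d \<bullet> v)" using descent[OF r v] by (simp add: inner_commute)
      ultimately show "\<exists>D\<ge>c. (F \<circ> x has_real_derivative D) (at r)" by metis
    qed
  qed
  ultimately have "c * (t - s) \<le> (F \<circ> x) t - (F \<circ> x) s"
    using s by (intro abs_continuous_growth)
  then show ?thesis by (simp add: F_def)
qed

text \<open>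
  Every \<open>\<phi>\<^sub>i'\<close> is increasing. A nonnegative coefficient needs only an upper bound for \<open>\<phi>\<^sub>i'\<close>, namely
  its value at the right end of the ball; a negative one occurs only where \<open>xbar\<^sub>i > 0\<close>, and there the ball stays
  away from the singularity at \<open>0\<close>.
\<close>

lemma mirror_variable_bounded_above:
  fixes xbar d :: "real ^ 'n"
  assumes kernel: "separable_kernel \<phi>" and xbar: "\<And>i. 0 \<le> xbar $ i"
    and d: "\<And>i. xbar $ i = 0 \<Longrightarrow> 0 \<le> d $ i"
    and r: "0 < r" "\<And>i. 0 < xbar $ i \<Longrightarrow> r < xbar $ i"
  shows "\<exists>B. \<forall>y \<in> ball xbar r \<inter> pos_orthant. (\<Sum>i\<in>UNIV. d $ i * deriv (\<phi> i) (y $ i)) \<le> B"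
proof -
  have "\<exists>B. \<forall>y \<in> ball xbar r \<inter> pos_orthant. d $ i * deriv (\<phi> i) (y $ i) \<le> B" for i
  proof -
    have y: "0 < y $ i" "xbar $ i - r \<le> y $ i" "y $ i \<le> xbar $ i + r" if "y \<in> ball xbar r \<inter> pos_orthant" for y
      using that component_le_norm_cart[of "xbar - y" i] by (auto simp: pos_orthant_def dist_norm)
    have hi: "deriv (\<phi> i) (y $ i) \<le> deriv (\<phi> i) (xbar $ i + r)" if "y \<in> ball xbar r \<inter> pos_orthant" for y
      using y[OF that] by (intro separable_kernel_deriv_mono[OF kernel])
    show ?thesis
    proof (cases "0 \<le> d $ i")
      case True
      then show ?thesis using hi by (intro exI[of _ "d $ i * deriv (\<phi> i) (xbar $ i + r)"]) (auto intro: mult_left_mono)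
    next
      case False
      then have "0 < xbar $ i" using d xbar[of i] by (auto simp: less_le)
      then have "deriv (\<phi> i) (xbar $ i - r) \<le> deriv (\<phi> i) (y $ i)" if "y \<in> ball xbar r \<inter> pos_orthant" for y
        using y[OF that] r(2)[of i] by (intro separable_kernel_deriv_mono[OF kernel]) auto
      then show ?thesis
        using False by (intro exI[of _ "d $ i * deriv (\<phi> i) (xbar $ i - r)"]) (auto intro!: mult_left_mono_neg)
    qed
  qed
  then obtain B where "\<And>i y. y \<in> ball xbar r \<inter> pos_orthant \<Longrightarrow> d $ i * deriv (\<phi> i) (y $ i) \<le> B i"
    by metis
  then show ?thesis by (intro exI[of _ "\<Sum>i\<in>UNIV. B i"]) (auto intro: sum_mono)
qed


section \<open>Exit times\<close>

text \<open>
  If the curve is outside \<open>N\<close> at some time \<open>t \<ge> \<tau>\<close>, no admissible duration exceeds \<open>t - \<tau>\<close>. This also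
  covers the case that the curve is not yet in \<open>N\<close> at the entry time itself.
\<close>

lemma exit_time_finite:
  assumes "exits_in_finite_time x N" and pos: "0 \<le> \<tau>" and fin: "\<tau> < \<infinity>" and W: "W \<subseteq> N"
  shows "exit_time x W \<tau> < \<infinity>"
proof -
  obtain s where s: "\<tau> = ereal s" "0 \<le> s" using pos fin by (cases \<tau>) auto
  obtain t where t: "s \<le> t" "x t \<notin> N"
  proof (cases "x s \<in> N")
    case True
    then show ?thesis
      using assms(1) s(2) that unfolding exits_in_finite_time_def by (meson less_imp_le)
  qed (use that in blast)
  have "Sup (ereal ` {T. 0 \<le> T \<and> (\<forall>t. \<tau> \<le> ereal t \<and> ereal t < \<tau> + ereal T \<longrightarrow> x t \<in> W)}) \<le> ereal (t - s)"
  proof (rule Sup_least, clarify)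
    fix T assume T: "\<forall>t. \<tau> \<le> ereal t \<and> ereal t < \<tau> + ereal T \<longrightarrow> x t \<in> W"
    from T[rule_format, of t] t W s show "ereal T \<le> ereal (t - s)" by force
  qed
  then have "exit_time x W \<tau> \<le> \<tau> + ereal (t - s)" unfolding exit_time_def by (rule add_left_mono)
  also have "\<dots> < \<infinity>" by (simp add: s)
  finally show ?thesis .
qed

lemma entry_time_ge: "T \<le> entry_time x W T"
  unfolding entry_time_def by (rule Inf_greatest) auto

lemma exit_time_ge: "\<tau> \<le> exit_time x W \<tau>"
proof -
  have "0 \<le> Sup (ereal ` {T. 0 \<le> T \<and> (\<forall>t. \<tau> \<le> ereal t \<and> ereal t < \<tau> + ereal T \<longrightarrow> x t \<in> W)})"
    by (rule Sup_upper) (auto simp: zero_ereal_def intro!: image_eqI[of _ _ 0])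
  then show ?thesis unfolding exit_time_def using add_left_mono by fastforce
qed

lemma exit_seq_nonneg: "0 \<le> exit_seq x W k"
proof (induction k)
  case (Suc k)
  also note entry_time_ge
  also note exit_time_ge
  finally show ?case by simp
qed simp


section \<open>Escape from spurious stationary points\<close>

theorem proposition3p7:
  fixes f :: "real ^ 'n \<Rightarrow> real"
    and A :: "real ^ 'n ^ 'm"
    and b :: "real ^ 'm"
    and \<phi> :: "'n \<Rightarrow> real \<Rightarrow> real"
    and x :: "real \<Rightarrow> real ^ 'n"
    and xbar :: "real ^ 'n"
  defines "C \<equiv> pos_orthant :: (real ^ 'n) set"
    and "M \<equiv> affine_set A b"
  assumes f_lipschitz: "locally_lipschitz f"
    and f_path_diff: "path_differentiable f"
    and full_row_rank: "rank A = CARD('m)"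
    and kernel: "separable_kernel \<phi>"
    and extension: "\<exists>G. continuous_on (M \<inter> closure C) G \<and>
          (\<forall>y \<in> M \<inter> C. G y = metric_proj A (separable \<phi>) y ** inv_hessian (separable \<phi>) y)"
    and trajectory: "is_trajectory f A b (separable \<phi>) x"
    and spurious: "xbar \<in> stable_set f A b (separable \<phi>) - stationary_set f A b"
  shows "\<exists>N. xbar \<in> interior N \<and>
           (\<forall>k. tau x (N \<inter> M \<inter> C) k < \<infinity> \<longrightarrow> Texit x (N \<inter> M \<inter> C) k < \<infinity>) \<and>
           exits_in_finite_time x N"
proof -
  have xbar: "xbar \<in> affine_set A b \<inter> closure pos_orthant" "xbar \<notin> stationary_set f A b"
    using spurious by (auto simp: stable_set_def)
  obtain d c where d: "A *v d = 0" "\<And>i. xbar $ i = 0 \<Longrightarrow> 0 \<le> d $ i" and c: "0 < c"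
    and descent: "\<And>v. v \<in> clarke_subdiff f xbar \<Longrightarrow> v \<bullet> d < - c"
    using descent_direction[OF f_lipschitz xbar] by metis
  obtain r1 where r1: "0 < r1" "\<And>y v. dist y xbar < r1 \<Longrightarrow> v \<in> clarke_subdiff f y \<Longrightarrow> v \<bullet> d < - c"
    using clarke_subdiff_halfspace_nearby[OF f_lipschitz descent] unfolding eventually_nhds_metric by blast
  have "\<exists>\<rho>>0. \<forall>i\<in>UNIV. 0 < xbar $ i \<longrightarrow> \<rho> < xbar $ i"
  proof -
    have "\<forall>\<^sub>F \<rho> in at_right 0. 0 < xbar $ i \<longrightarrow> \<rho> < xbar $ i" for i
      by (cases "0 < xbar $ i") (auto intro: order_tendstoD[OF tendsto_ident_at])
    then have "\<forall>\<^sub>F \<rho> in at_right 0. (\<forall>i\<in>UNIV. 0 < xbar $ i \<longrightarrow> \<rho> < xbar $ i) \<and> 0 < \<rho>"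
      by (intro eventually_conj eventually_ball_finite eventually_at_right_less) auto
    then show ?thesis by (auto dest: eventually_happens'[rotated])
  qed
  then obtain \<rho> where \<rho>: "0 < \<rho>" "\<And>i. 0 < xbar $ i \<Longrightarrow> \<rho> < xbar $ i" by auto
  define r where "r = min r1 \<rho>"
  have r: "0 < r" "\<And>i. 0 < xbar $ i \<Longrightarrow> r < xbar $ i"
    using r1(1) \<rho> by (auto simp: r_def min_less_iff_disj)
  define N where "N = ball xbar r"
  have xbar_nonneg: "0 \<le> xbar $ i" for i
    using xbar closure_pos_orthant_nonneg by blast
  obtain B where B: "\<And>y. y \<in> N \<Longrightarrow> y \<in> pos_orthant \<Longrightarrow> (\<Sum>i\<in>UNIV. d $ i * deriv (\<phi> i) (y $ i)) \<le> B"
    using mirror_variable_bounded_above[OF kernel xbar_nonneg d(2) r] unfolding N_def by blast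
  have exits: "exits_in_finite_time x N"
    unfolding exits_in_finite_time_def
  proof (intro allI impI)
    fix s :: real assume s: "0 \<le> s" "x s \<in> N"
    show "\<exists>t>s. x t \<notin> N"
    proof (rule ccontr)
      assume "\<not> (\<exists>t>s. x t \<notin> N)"
      then have stay: "x t \<in> N" if "s < t" for t using that by blast
      define \<beta> where "\<beta> = (\<Sum>i\<in>UNIV. d $ i * deriv (\<phi> i) (x s $ i))"
      \<comment> \<open>Late enough that growth at rate \<open>c\<close> would exceed the upper bound \<open>B\<close>.\<close>
      define t where "t = s + (\<bar>B - \<beta>\<bar> + 1) / c"
      have t: "s < t" using c by (simp add: t_def add_pos_nonneg)
      have "c * (t - s) \<le> (\<Sum>i\<in>UNIV. d $ i * deriv (\<phi> i) (x t $ i)) - \<beta>"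
        unfolding \<beta>_def
      proof (rule mirror_variable_growth[OF kernel trajectory d(1) s(1)])
        fix u v assume "s < u" "v \<in> clarke_subdiff f (x u)"
        then show "v \<bullet> d \<le> - c"
          using r1(2)[of "x u" v] stay[of u] by (auto simp: N_def r_def dist_commute)
      qed (use t in simp)
      also have "\<dots> \<le> B - \<beta>"
        using B[OF stay[OF t]] trajectory s(1) t unfolding is_trajectory_def by auto
      finally show False using c by (simp add: t_def)
    qed
  qed
  have "Texit x (N \<inter> M \<inter> C) k < \<infinity>" if "tau x (N \<inter> M \<inter> C) k < \<infinity>" for k
    using that exit_seq_nonneg[of x "N \<inter> M \<inter> C" k] entry_time_ge[of "exit_seq x (N \<inter> M \<inter> C) k" x "N \<inter> M \<inter> C"]
    unfolding Texit_def tau_def exit_seq.simps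
    by (intro exit_time_finite[OF exits]) auto
  moreover have "xbar \<in> interior N" using r(1) by (simp add: N_def interior_open)
  ultimately show ?thesis using exits by blast
qed

end
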